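(* Let $R_1$ and $R_2$ be commutative rings with nonzero identity, let $R=R_1\times R_2$, let $\delta_i$ be an expansion function of ideals of $R_i$ for $i=1,2$, and let $I$ be an ideal of $R$. Then the following statements are equivalent: (1) $I$ is a $1$-absorbing $\delta_\times$-primary ideal of $R$. (2) $I$ is a $\delta_\times$-primary ideal of $R$. (3) Either $I=I_1\times R_2$, where $I_1$ is a $\delta_1$-primary ideal of $R_1$; or $I=R_1\times I_2$, where $I_2$ is a $\delta_2$-primary ideal of $R_2$; or $I=I_1\times I_2$, where $I_1$ and $I_2$ are proper ideals of $R_1$ and $R_2$, respectively, with $\delta_1(I_1)=R_1$ and $\delta_2(I_2)=R_2$.
   Context: For a commutative ring $T$ with nonzero identity, $\mathcal{I}(T)$ denotes the set of all ideals of $T$. A function $\delta:\mathcal{I}(T)\to\mathcal{I}(T)$ is an expansion function of ideals of $T$ if $L\subseteq\delta(L)$ for every ideal $L$, and $J\subseteq I$ implies $\delta(J)\subseteq\delta(I)$ for all ideals $I,J$. A proper ideal $I$ of $T$ is $1$-absorbing $\delta$-primary if whenever $a,b,c\in T$ are nonunits with $abc\in I$, then $ab\in I$ or $c\in\delta(I)$. A proper ideal $I$ of $T$ is $\delta$-primary if whenever $a,b\in T$ with $ab\in I$, then $a\in I$ or $b\in\delta(I)$. Every ideal of $R_1\times R_2$ has the form $I_1\times I_2$ with $I_i$ an ideal of $R_i$, and $\delta_\times$ is the expansion function of ideals of $R_1\times R_2$ defined by $\delta_\times(I_1\times I_2)=\delta_1(I_1)\times\delta_2(I_2)$. *)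

theory Defs
  imports "HOL-Algebra.Algebra"
begin

definition proper_ideal :: "'a set \<Rightarrow> ('a, 'm) ring_scheme \<Rightarrow> bool" where
  "proper_ideal I T \<longleftrightarrow> ideal I T \<and> I \<noteq> carrier T"

text \<open>Expansion functions are total functions on sets; only their values on ideals are
  constrained, and only these values are relevant.\<close>

definition expansion_function :: "('a, 'm) ring_scheme \<Rightarrow> ('a set \<Rightarrow> 'a set) \<Rightarrow> bool" where
  "expansion_function T \<delta> \<longleftrightarrow>
     (\<forall>L. ideal L T \<longrightarrow> ideal (\<delta> L) T \<and> L \<subseteq> \<delta> L) \<and>
     (\<forall>I J. ideal I T \<longrightarrow> ideal J T \<longrightarrow> J \<subseteq> I \<longrightarrow> \<delta> J \<subseteq> \<delta> I)"

definition one_absorbing_delta_primary ::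
    "('a, 'm) ring_scheme \<Rightarrow> ('a set \<Rightarrow> 'a set) \<Rightarrow> 'a set \<Rightarrow> bool" where
  "one_absorbing_delta_primary T \<delta> I \<longleftrightarrow>
     proper_ideal I T \<and>
     (\<forall>a \<in> carrier T - Units T. \<forall>b \<in> carrier T - Units T. \<forall>c \<in> carrier T - Units T.
        a \<otimes>\<^bsub>T\<^esub> b \<otimes>\<^bsub>T\<^esub> c \<in> I \<longrightarrow> a \<otimes>\<^bsub>T\<^esub> b \<in> I \<or> c \<in> \<delta> I)"

definition delta_primary ::
    "('a, 'm) ring_scheme \<Rightarrow> ('a set \<Rightarrow> 'a set) \<Rightarrow> 'a set \<Rightarrow> bool" where
  "delta_primary T \<delta> I \<longleftrightarrow>
     proper_ideal I T \<and>
     (\<forall>a \<in> carrier T. \<forall>b \<in> carrier T. a \<otimes>\<^bsub>T\<^esub> b \<in> I \<longrightarrow> a \<in> I \<or> b \<in> \<delta> I)"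

text \<open>An ideal of a product ring is the product \<open>I1 \<times> I2\<close> of its two projections, so the
  factors are recovered as images under \<^const>\<open>fst\<close> and \<^const>\<open>snd\<close>; the lemmas below show that
  this yields the intended function on ideals.\<close>

definition delta_times ::
    "('a set \<Rightarrow> 'a set) \<Rightarrow> ('b set \<Rightarrow> 'b set) \<Rightarrow> ('a \<times> 'b) set \<Rightarrow> ('a \<times> 'b) set" where
  "delta_times \<delta>1 \<delta>2 J = \<delta>1 (fst ` J) \<times> \<delta>2 (snd ` J)"

lemma delta_times_Times:
  assumes "ideal I1 R1" and "ideal I2 R2"
  shows "delta_times \<delta>1 \<delta>2 (I1 \<times> I2) = \<delta>1 I1 \<times> \<delta>2 I2"
proof -
  have "I1 \<noteq> {}" "I2 \<noteq> {}"
    using assms additive_subgroup.zero_closed ideal.axioms(1) by blast+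
  then show ?thesis by (simp add: delta_times_def)
qed

lemma RDirProd_simps:
  "carrier (RDirProd R S) = carrier R \<times> carrier S"
  "(a, b) \<otimes>\<^bsub>RDirProd R S\<^esub> (c, d) = (a \<otimes>\<^bsub>R\<^esub> c, b \<otimes>\<^bsub>S\<^esub> d)"
  "(a, b) \<oplus>\<^bsub>RDirProd R S\<^esub> (c, d) = (a \<oplus>\<^bsub>R\<^esub> c, b \<oplus>\<^bsub>S\<^esub> d)"
  "\<one>\<^bsub>RDirProd R S\<^esub> = (\<one>\<^bsub>R\<^esub>, \<one>\<^bsub>S\<^esub>)"
  "\<zero>\<^bsub>RDirProd R S\<^esub> = (\<zero>\<^bsub>R\<^esub>, \<zero>\<^bsub>S\<^esub>)"
  by (auto simp: RDirProd_def DirProd_def monoid.defs)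

lemma ideal_criterion:
  assumes "ring R" "I \<subseteq> carrier R" "\<zero>\<^bsub>R\<^esub> \<in> I"
    and add: "\<And>a b. a \<in> I \<Longrightarrow> b \<in> I \<Longrightarrow> a \<oplus>\<^bsub>R\<^esub> b \<in> I"
    and l: "\<And>a x. a \<in> I \<Longrightarrow> x \<in> carrier R \<Longrightarrow> x \<otimes>\<^bsub>R\<^esub> a \<in> I"
    and r: "\<And>a x. a \<in> I \<Longrightarrow> x \<in> carrier R \<Longrightarrow> a \<otimes>\<^bsub>R\<^esub> x \<in> I"
  shows "ideal I R"
proof (rule idealI)
  interpret ring R by fact
  show "ring R" by fact
  have "\<ominus>\<^bsub>R\<^esub> a \<in> I" if "a \<in> I" for a
  proof -
    have "a \<in> carrier R" using that assms(2) by blast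
    then have "\<ominus>\<^bsub>R\<^esub> a = (\<ominus>\<^bsub>R\<^esub> \<one>\<^bsub>R\<^esub>) \<otimes>\<^bsub>R\<^esub> a" by (simp add: l_minus)
    then show ?thesis using l[OF that] by simp
  qed
  then show "subgroup I (add_monoid R)"
    using assms(2,3) add by (intro add.subgroupI) (auto simp: a_inv_def)
qed (use l r in auto)

lemma ideal_Times:
  assumes "ideal I1 R1" "ideal I2 R2"
  shows "ideal (I1 \<times> I2) (RDirProd R1 R2)"
proof -
  interpret i1: ideal I1 R1 by fact
  interpret i2: ideal I2 R2 by fact
  show ?thesis
    by (rule ideal_criterion)
      (auto simp: RDirProd_simps i1.I_l_closed i1.I_r_closed i2.I_l_closed i2.I_r_closed
        intro: RDirProd_ring i1.ring_axioms i2.ring_axioms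
        dest: i1.a_subset[THEN subsetD] i2.a_subset[THEN subsetD])
qed

lemma ideal_RDirProd:
  assumes "ring R1" "ring R2" "ideal J (RDirProd R1 R2)"
  shows "ideal (fst ` J) R1" "ideal (snd ` J) R2" "J = fst ` J \<times> snd ` J"
proof -
  interpret r1: ring R1 by fact
  interpret r2: ring R2 by fact
  interpret j: ideal J "RDirProd R1 R2" by fact
  have car: "x \<in> carrier R1 \<and> y \<in> carrier R2" if "(x, y) \<in> J" for x y
    using j.a_subset that by (auto simp: RDirProd_simps)
  have add: "(x \<oplus>\<^bsub>R1\<^esub> x', y \<oplus>\<^bsub>R2\<^esub> y') \<in> J" if "(x, y) \<in> J" "(x', y') \<in> J" for x y x' y'
    using additive_subgroup.a_closed[OF j.is_additive_subgroup that] by (simp add: RDirProd_simps)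
  have zero: "(\<zero>\<^bsub>R1\<^esub>, \<zero>\<^bsub>R2\<^esub>) \<in> J"
    using additive_subgroup.zero_closed[OF j.is_additive_subgroup] by (simp add: RDirProd_simps)
  have l: "(u \<otimes>\<^bsub>R1\<^esub> x, v \<otimes>\<^bsub>R2\<^esub> y) \<in> J"
    if "(x, y) \<in> J" "u \<in> carrier R1" "v \<in> carrier R2" for x y u v
    using j.I_l_closed[OF that(1), of "(u, v)"] that by (simp add: RDirProd_simps)
  have r: "(x \<otimes>\<^bsub>R1\<^esub> u, y \<otimes>\<^bsub>R2\<^esub> v) \<in> J"
    if "(x, y) \<in> J" "u \<in> carrier R1" "v \<in> carrier R2" for x y u v
    using j.I_r_closed[OF that(1), of "(u, v)"] that by (simp add: RDirProd_simps)
  have fst1: "x \<in> fst ` J" if "(x, y) \<in> J" for x y using imageI[OF that, of fst] by simp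
  have snd1: "y \<in> snd ` J" if "(x, y) \<in> J" for x y using imageI[OF that, of snd] by simp
  show "ideal (fst ` J) R1"
  proof (rule ideal_criterion[OF assms(1)])
    show "fst ` J \<subseteq> carrier R1" using car by auto
    show "\<zero>\<^bsub>R1\<^esub> \<in> fst ` J" by (rule fst1[OF zero])
    show "a \<oplus>\<^bsub>R1\<^esub> b \<in> fst ` J" if ab: "a \<in> fst ` J" "b \<in> fst ` J" for a b
    proof -
      obtain u v where "(a, u) \<in> J" "(b, v) \<in> J" using ab by auto
      then show ?thesis by (rule fst1[OF add])
    qed
    show "x \<otimes>\<^bsub>R1\<^esub> a \<in> fst ` J" "a \<otimes>\<^bsub>R1\<^esub> x \<in> fst ` J"
      if a: "a \<in> fst ` J" and x: "x \<in> carrier R1" for a x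
    proof -
      obtain u where u: "(a, u) \<in> J" using a by auto
      show "x \<otimes>\<^bsub>R1\<^esub> a \<in> fst ` J" by (rule fst1[OF l[OF u x r2.one_closed]])
      show "a \<otimes>\<^bsub>R1\<^esub> x \<in> fst ` J" by (rule fst1[OF r[OF u x r2.one_closed]])
    qed
  qed
  show "ideal (snd ` J) R2"
  proof (rule ideal_criterion[OF assms(2)])
    show "snd ` J \<subseteq> carrier R2" using car by auto
    show "\<zero>\<^bsub>R2\<^esub> \<in> snd ` J" by (rule snd1[OF zero])
    show "a \<oplus>\<^bsub>R2\<^esub> b \<in> snd ` J" if ab: "a \<in> snd ` J" "b \<in> snd ` J" for a b
    proof -
      obtain u v where "(u, a) \<in> J" "(v, b) \<in> J" using ab by auto
      then show ?thesis by (rule snd1[OF add])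
    qed
    show "x \<otimes>\<^bsub>R2\<^esub> a \<in> snd ` J" "a \<otimes>\<^bsub>R2\<^esub> x \<in> snd ` J"
      if a: "a \<in> snd ` J" and x: "x \<in> carrier R2" for a x
    proof -
      obtain u where u: "(u, a) \<in> J" using a by auto
      show "x \<otimes>\<^bsub>R2\<^esub> a \<in> snd ` J" by (rule snd1[OF l[OF u r1.one_closed x]])
      show "a \<otimes>\<^bsub>R2\<^esub> x \<in> snd ` J" by (rule snd1[OF r[OF u r1.one_closed x]])
    qed
  qed
  have mix: "(x, y') \<in> J" if J: "(x, y) \<in> J" "(x', y') \<in> J" for x y x' y'
    using add[OF l[OF J(1) r1.one_closed r2.zero_closed] l[OF J(2) r1.zero_closed r2.one_closed]]
      car[OF J(1)] car[OF J(2)] by simp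
  show "J = fst ` J \<times> snd ` J"
  proof (rule subset_antisym)
    show "J \<subseteq> fst ` J \<times> snd ` J" by (rule subset_fst_snd)
    show "fst ` J \<times> snd ` J \<subseteq> J"
    proof (rule subsetI)
      fix p assume "p \<in> fst ` J \<times> snd ` J"
      then obtain q r where "q \<in> J" "r \<in> J" "p = (fst q, snd r)"
        by (auto simp only: mem_Times_iff image_iff prod_eq_iff fst_conv snd_conv)
      then show "p \<in> J" using mix[of "fst q" "snd q" "fst r" "snd r"] by simp
    qed
  qed
qed

lemma expansion_function_delta_times:
  assumes "ring R1" "ring R2" "expansion_function R1 \<delta>1" "expansion_function R2 \<delta>2"
  shows "expansion_function (RDirProd R1 R2) (delta_times \<delta>1 \<delta>2)"
proof -
  note e1 = assms(3)[unfolded expansion_function_def]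
  note e2 = assms(4)[unfolded expansion_function_def]
  note id = ideal_RDirProd[OF assms(1,2)]
  have "ideal (delta_times \<delta>1 \<delta>2 L) (RDirProd R1 R2) \<and> L \<subseteq> delta_times \<delta>1 \<delta>2 L"
    if L: "ideal L (RDirProd R1 R2)" for L
  proof -
    have a: "ideal (\<delta>1 (fst ` L)) R1" "fst ` L \<subseteq> \<delta>1 (fst ` L)"
      using conjunct1[OF e1] id(1)[OF L] by simp_all
    have b: "ideal (\<delta>2 (snd ` L)) R2" "snd ` L \<subseteq> \<delta>2 (snd ` L)"
      using conjunct1[OF e2] id(2)[OF L] by simp_all
    show ?thesis unfolding delta_times_def
      using ideal_Times[OF a(1) b(1)] a(2) b(2) by (auto simp: image_subset_iff)
  qed
  moreover have "delta_times \<delta>1 \<delta>2 J \<subseteq> delta_times \<delta>1 \<delta>2 I"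
    if I: "ideal I (RDirProd R1 R2)" and J: "ideal J (RDirProd R1 R2)" and "J \<subseteq> I" for I J
  proof -
    have "fst ` J \<subseteq> fst ` I" "snd ` J \<subseteq> snd ` I" using \<open>J \<subseteq> I\<close> by auto
    then have "\<delta>1 (fst ` J) \<subseteq> \<delta>1 (fst ` I)" "\<delta>2 (snd ` J) \<subseteq> \<delta>2 (snd ` I)"
      using conjunct2[OF e1] conjunct2[OF e2] id(1)[OF I] id(2)[OF I] id(1)[OF J] id(2)[OF J]
      by simp_all
    then show ?thesis unfolding delta_times_def by blast
  qed
  ultimately show ?thesis unfolding expansion_function_def by blast
qed

end

theory Submission
  imports Defs
begin

text \<open>The key point is that every element of a product of two nonzero rings with a zero
  coordinate is a nonunit, so the \<open>1\<close>-absorbing condition applies to such elements without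
  further restriction. If \<open>I = I1 \<times> R2\<close>, applying it to \<open>(1, 0) \<cdot> (a, 0) \<cdot> (b, 0)\<close> gives that \<open>I1\<close> is
  primary. If both factors are proper, applying it to \<open>(1, 0) \<cdot> (1, 0) \<cdot> (0, 1) = 0\<close> and its mirror image
  forces \<open>1 \<in> \<delta>i Ii\<close> for both \<open>i\<close>.\<close>

text \<open>Group a triple product as \<open>(a \<otimes> b) \<otimes> c\<close>: the
  \<delta>-primary condition for the pair \<open>a \<otimes> b\<close>, \<open>c\<close> is the
  required alternative.\<close>

lemma delta_primary_imp_one_absorbing:
  assumes "ring T" "delta_primary T \<delta> I"
  shows "one_absorbing_delta_primary T \<delta> I"
proof -
  interpret ring T by fact
  show ?thesis
    using assms(2) unfolding delta_primary_def one_absorbing_delta_primary_def by auto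
qed

text \<open>An inverse would give \<open>\<zero> = \<one>\<close> in the factor where the coordinate
  vanishes.\<close>

lemma RDirProd_zero_nonunit:
  assumes "ring R1" "ring R2" "\<one>\<^bsub>R1\<^esub> \<noteq> \<zero>\<^bsub>R1\<^esub>" "\<one>\<^bsub>R2\<^esub> \<noteq> \<zero>\<^bsub>R2\<^esub>"
  shows "y \<in> carrier R2 \<Longrightarrow> (\<zero>\<^bsub>R1\<^esub>, y) \<in> carrier (RDirProd R1 R2) - Units (RDirProd R1 R2)"
    and "x \<in> carrier R1 \<Longrightarrow> (x, \<zero>\<^bsub>R2\<^esub>) \<in> carrier (RDirProd R1 R2) - Units (RDirProd R1 R2)"
proof -
  interpret r1: ring R1 by fact
  interpret r2: ring R2 by fact
  show "y \<in> carrier R2 \<Longrightarrow> (\<zero>\<^bsub>R1\<^esub>, y) \<in> carrier (RDirProd R1 R2) - Units (RDirProd R1 R2)"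
    and "x \<in> carrier R1 \<Longrightarrow> (x, \<zero>\<^bsub>R2\<^esub>) \<in> carrier (RDirProd R1 R2) - Units (RDirProd R1 R2)"
    using assms(3,4) by (auto simp: Units_def RDirProd_simps)
qed

text \<open>Ensures that a full factor of a product ideal stays full under
  \<open>delta_times\<close>, so that only the other coordinate carries a condition.\<close>

lemma expansion_function_carrier:
  assumes "ring T" "expansion_function T \<delta>"
  shows "\<delta> (carrier T) = carrier T"
proof -
  have "ideal (carrier T) T"
    by (rule ring.oneideal[OF assms(1)])
  then have "ideal (\<delta> (carrier T)) T" "carrier T \<subseteq> \<delta> (carrier T)"
    using assms(2) unfolding expansion_function_def by blast+
  moreover from this have "\<delta> (carrier T) \<subseteq> carrier T"
    by (simp add: ideal.Icarr subsetI)
  ultimately show ?thesis by blast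
qed

lemma proper_ideal_Times_iff:
  assumes "ideal I1 R1" "ideal I2 R2"
  shows "proper_ideal (I1 \<times> I2) (RDirProd R1 R2) \<longleftrightarrow> I1 \<noteq> carrier R1 \<or> I2 \<noteq> carrier R2"
proof -
  \<comment> \<open>A product of sets determines its factors only when neither is empty; ideals
    contain zero.\<close>
  have "I1 \<noteq> {}" "I2 \<noteq> {}"
    using assms additive_subgroup.zero_closed ideal.axioms(1) by blast+
  then show ?thesis
    using ideal_Times[OF assms] by (auto simp: proper_ideal_def RDirProd_simps times_eq_iff)
qed

lemma one_absorbing_TimesD:
  assumes "ring R1" "\<one>\<^bsub>R1\<^esub> \<noteq> \<zero>\<^bsub>R1\<^esub>" "ring R2" "\<one>\<^bsub>R2\<^esub> \<noteq> \<zero>\<^bsub>R2\<^esub>"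
    and e: "expansion_function R1 \<delta>1" "expansion_function R2 \<delta>2"
    and i: "ideal I1 R1" "ideal I2 R2"
    and abs: "one_absorbing_delta_primary (RDirProd R1 R2) (delta_times \<delta>1 \<delta>2) (I1 \<times> I2)"
  shows "I1 = carrier R1 \<Longrightarrow> delta_primary R2 \<delta>2 I2"
    and "I2 = carrier R2 \<Longrightarrow> delta_primary R1 \<delta>1 I1"
    and "I1 \<noteq> carrier R1 \<Longrightarrow> \<delta>2 I2 = carrier R2"
    and "I2 \<noteq> carrier R2 \<Longrightarrow> \<delta>1 I1 = carrier R1"
proof -
  interpret r1: ring R1 by fact
  interpret r2: ring R2 by fact
  interpret i1: ideal I1 R1 by fact
  interpret i2: ideal I2 R2 by fact
  let ?R = "RDirProd R1 R2"
  note nonunit = RDirProd_zero_nonunit[OF assms(1,3,2,4)]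
  have d: "ideal (\<delta>1 I1) R1" "ideal (\<delta>2 I2) R2"
    using e i unfolding expansion_function_def by blast+
  \<comment> \<open>When one factor is full, this makes the other one proper, as
    \<open>delta_primary\<close> demands.\<close>
  have proper: "I1 \<noteq> carrier R1 \<or> I2 \<noteq> carrier R2"
    using abs proper_ideal_Times_iff[OF i] unfolding one_absorbing_delta_primary_def by blast
  have absD: "p \<otimes>\<^bsub>?R\<^esub> q \<in> I1 \<times> I2 \<or> r \<in> \<delta>1 I1 \<times> \<delta>2 I2"
    if "p \<in> carrier ?R - Units ?R" "q \<in> carrier ?R - Units ?R" "r \<in> carrier ?R - Units ?R"
      "p \<otimes>\<^bsub>?R\<^esub> q \<otimes>\<^bsub>?R\<^esub> r \<in> I1 \<times> I2" for p q r
    using abs that delta_times_Times[OF i, of \<delta>1 \<delta>2]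
    unfolding one_absorbing_delta_primary_def by metis
  show "delta_primary R2 \<delta>2 I2" if "I1 = carrier R1"
    unfolding delta_primary_def proper_ideal_def
  proof (intro conjI ballI impI)
    fix a b assume ab: "a \<in> carrier R2" "b \<in> carrier R2" "a \<otimes>\<^bsub>R2\<^esub> b \<in> I2"
    \<comment> \<open>The triple is \<open>(\<zero>, \<one>)\<close>, \<open>(\<zero>, a)\<close>,
      \<open>(\<zero>, b)\<close>. The factor \<open>(\<zero>, \<one>)\<close> pads the pair to
      three nonunits without changing second coordinates, and \<open>\<zero> \<in> I1\<close> puts
      the product in \<open>I1 \<times> I2\<close>.\<close>
    then show "a \<in> I2 \<or> b \<in> \<delta>2 I2"
      using absD[OF nonunit(1)[OF r2.one_closed] nonunit(1)[OF ab(1)] nonunit(1)[OF ab(2)]]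
      by (simp add: RDirProd_simps) blast
  qed (use i proper that in auto)
  show "delta_primary R1 \<delta>1 I1" if "I2 = carrier R2"
    unfolding delta_primary_def proper_ideal_def
  proof (intro conjI ballI impI)
    fix a b assume ab: "a \<in> carrier R1" "b \<in> carrier R1" "a \<otimes>\<^bsub>R1\<^esub> b \<in> I1"
    then show "a \<in> I1 \<or> b \<in> \<delta>1 I1"
      using absD[OF nonunit(2)[OF r1.one_closed] nonunit(2)[OF ab(1)] nonunit(2)[OF ab(2)]]
      by (simp add: RDirProd_simps) blast
  qed (use i proper that in auto)
  show "\<delta>2 I2 = carrier R2" if "I1 \<noteq> carrier R1"
  proof -
    have "\<one>\<^bsub>R1\<^esub> \<notin> I1" using that i1.one_imp_carrier by blast
    \<comment> \<open>The first two factors multiply to \<open>(\<one>, \<zero>)\<close>, which lies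
      outside \<open>I1 \<times> I2\<close>, so the third factor \<open>(\<zero>, \<one>)\<close>
      must lie in \<open>\<delta>1 I1 \<times> \<delta>2 I2\<close>.\<close>
    then have "\<one>\<^bsub>R2\<^esub> \<in> \<delta>2 I2"
      using absD[OF nonunit(2) nonunit(2) nonunit(1), of "\<one>\<^bsub>R1\<^esub>" "\<one>\<^bsub>R1\<^esub>" "\<one>\<^bsub>R2\<^esub>"]
      by (simp add: RDirProd_simps)
    then show ?thesis using ideal.one_imp_carrier[OF d(2)] by blast
  qed
  show "\<delta>1 I1 = carrier R1" if "I2 \<noteq> carrier R2"
  proof -
    have "\<one>\<^bsub>R2\<^esub> \<notin> I2" using that i2.one_imp_carrier by blast
    then have "\<one>\<^bsub>R1\<^esub> \<in> \<delta>1 I1"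
      using absD[OF nonunit(1) nonunit(1) nonunit(2), of "\<one>\<^bsub>R2\<^esub>" "\<one>\<^bsub>R2\<^esub>" "\<one>\<^bsub>R1\<^esub>"]
      by (simp add: RDirProd_simps)
    then show ?thesis using ideal.one_imp_carrier[OF d(1)] by blast
  qed
qed

text \<open>With one full factor, both the hypothesis on \<open>a \<otimes> b\<close> and the
  conclusion reduce to the other coordinate. In the last case \<open>delta_times\<close> sends
  \<open>I1 \<times> I2\<close> to the whole ring, so the second alternative always holds.\<close>

lemma delta_primary_TimesI:
  assumes "ring R1" "ring R2"
    and e: "expansion_function R1 \<delta>1" "expansion_function R2 \<delta>2"
  shows "delta_primary R1 \<delta>1 I1 \<Longrightarrow>
      delta_primary (RDirProd R1 R2) (delta_times \<delta>1 \<delta>2) (I1 \<times> carrier R2)"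
    and "delta_primary R2 \<delta>2 I2 \<Longrightarrow>
      delta_primary (RDirProd R1 R2) (delta_times \<delta>1 \<delta>2) (carrier R1 \<times> I2)"
    and "proper_ideal I1 R1 \<Longrightarrow> proper_ideal I2 R2 \<Longrightarrow>
      \<delta>1 I1 = carrier R1 \<Longrightarrow> \<delta>2 I2 = carrier R2 \<Longrightarrow>
      delta_primary (RDirProd R1 R2) (delta_times \<delta>1 \<delta>2) (I1 \<times> I2)"
proof -
  note one = ring.oneideal[OF assms(1)] ring.oneideal[OF assms(2)]
  note carr = expansion_function_carrier[OF assms(1) e(1)] expansion_function_carrier[OF assms(2) e(2)]
  show "delta_primary (RDirProd R1 R2) (delta_times \<delta>1 \<delta>2) (I1 \<times> carrier R2)"
    if p: "delta_primary R1 \<delta>1 I1"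
  proof -
    have i: "ideal I1 R1" "I1 \<noteq> carrier R1"
      using p by (auto simp: delta_primary_def proper_ideal_def)
    show ?thesis
      using p i proper_ideal_Times_iff[OF i(1) one(2)]
      by (auto simp: delta_primary_def delta_times_Times[OF i(1) one(2)] carr RDirProd_simps)
  qed
  show "delta_primary (RDirProd R1 R2) (delta_times \<delta>1 \<delta>2) (carrier R1 \<times> I2)"
    if p: "delta_primary R2 \<delta>2 I2"
  proof -
    have i: "ideal I2 R2" "I2 \<noteq> carrier R2"
      using p by (auto simp: delta_primary_def proper_ideal_def)
    show ?thesis
      using p i proper_ideal_Times_iff[OF one(1) i(1)]
      by (auto simp: delta_primary_def delta_times_Times[OF one(1) i(1)] carr RDirProd_simps)
  qed
  show "delta_primary (RDirProd R1 R2) (delta_times \<delta>1 \<delta>2) (I1 \<times> I2)"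
    if "proper_ideal I1 R1" "proper_ideal I2 R2" "\<delta>1 I1 = carrier R1" "\<delta>2 I2 = carrier R2"
  proof -
    have i: "ideal I1 R1" "ideal I2 R2" "I1 \<noteq> carrier R1"
      using that by (auto simp: proper_ideal_def)
    show ?thesis
      using that i(3) proper_ideal_Times_iff[OF i(1,2)]
      by (auto simp: delta_primary_def delta_times_Times[OF i(1,2)] RDirProd_simps)
  qed
qed

theorem theorem2p28:
  fixes R1 :: "('a, 'm) ring_scheme" and R2 :: "('b, 'n) ring_scheme"
    and \<delta>1 :: "'a set \<Rightarrow> 'a set" and \<delta>2 :: "'b set \<Rightarrow> 'b set"
    and I :: "('a \<times> 'b) set"
  assumes "cring R1" and "\<one>\<^bsub>R1\<^esub> \<noteq> \<zero>\<^bsub>R1\<^esub>"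
    and "cring R2" and "\<one>\<^bsub>R2\<^esub> \<noteq> \<zero>\<^bsub>R2\<^esub>"
    and "expansion_function R1 \<delta>1" and "expansion_function R2 \<delta>2"
    and "ideal I (RDirProd R1 R2)"
  shows "(one_absorbing_delta_primary (RDirProd R1 R2) (delta_times \<delta>1 \<delta>2) I \<longleftrightarrow>
            delta_primary (RDirProd R1 R2) (delta_times \<delta>1 \<delta>2) I) \<and>
         (delta_primary (RDirProd R1 R2) (delta_times \<delta>1 \<delta>2) I \<longleftrightarrow>
            (\<exists>I1. delta_primary R1 \<delta>1 I1 \<and> I = I1 \<times> carrier R2) \<or>
            (\<exists>I2. delta_primary R2 \<delta>2 I2 \<and> I = carrier R1 \<times> I2) \<or>
            (\<exists>I1 I2. proper_ideal I1 R1 \<and> proper_ideal I2 R2 \<and> I = I1 \<times> I2 \<and>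
               \<delta>1 I1 = carrier R1 \<and> \<delta>2 I2 = carrier R2))"
proof -
  let ?R = "RDirProd R1 R2" and ?\<delta> = "delta_times \<delta>1 \<delta>2"
  let ?S = "(\<exists>I1. delta_primary R1 \<delta>1 I1 \<and> I = I1 \<times> carrier R2) \<or>
            (\<exists>I2. delta_primary R2 \<delta>2 I2 \<and> I = carrier R1 \<times> I2) \<or>
            (\<exists>I1 I2. proper_ideal I1 R1 \<and> proper_ideal I2 R2 \<and> I = I1 \<times> I2 \<and>
               \<delta>1 I1 = carrier R1 \<and> \<delta>2 I2 = carrier R2)"
  note rings = cring.axioms(1)[OF assms(1)] cring.axioms(1)[OF assms(3)]
  obtain I1 I2 where i: "ideal I1 R1" "ideal I2 R2" and I: "I = I1 \<times> I2"
    using ideal_RDirProd[OF rings assms(7)] by blast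
  \<comment> \<open>The equivalences follow from a cycle: 1-absorbing implies \<open>?S\<close>,
    which implies \<delta>-primary, which implies 1-absorbing.\<close>
  have "?S" if "one_absorbing_delta_primary ?R ?\<delta> I"
  proof -
    note D = one_absorbing_TimesD[OF rings(1) assms(2) rings(2) assms(4-6) i that[unfolded I]]
    \<comment> \<open>The first two cases may overlap formally, but \<open>D(1)\<close> and
      \<open>D(2)\<close> already include properness of the other factor.\<close>
    consider "I1 = carrier R1" | "I2 = carrier R2" | "I1 \<noteq> carrier R1" "I2 \<noteq> carrier R2"
      by blast
    then show ?thesis
    proof cases
      case 1
      with D(1) I show ?thesis by blast
    next
      case 2
      with D(2) I show ?thesis by blast
    next
      case 3
      then have "proper_ideal I1 R1" "proper_ideal I2 R2"
        using i by (simp_all add: proper_ideal_def)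
      with D(3,4) 3 I show ?thesis by blast
    qed
  qed
  moreover have "delta_primary ?R ?\<delta> I" if ?S
    using that delta_primary_TimesI[OF rings assms(5,6)] by blast
  moreover have "one_absorbing_delta_primary ?R ?\<delta> I" if "delta_primary ?R ?\<delta> I"
    using delta_primary_imp_one_absorbing[OF RDirProd_ring[OF rings] that] .
  ultimately show ?thesis by blast
qed

end
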